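(* Let $\beta\in B_3$ be a 3-braid. Then $d_t(\widehat\beta)$ is determined by the $s$ invariant and the writhe; precisely, one of the following holds: (1) $s(\widehat\beta)=w(\widehat\beta)-2$ and $d_t(\widehat\beta)=w(\widehat\beta)-3+3t$ for all $t\in[0,1]$; (2) $s(\widehat\beta)=w(\widehat\beta)$ and $d_t(\widehat\beta)=w(\widehat\beta)-1+t$ for all $t\in[0,1]$; (3) $s(\widehat\beta)=w(\widehat\beta)+2$ and $d_t(\widehat\beta)=w(\widehat\beta)+1-t$ for all $t\in[0,1]$.
   Context: $B_n$ is the braid group with Artin generators $\sigma_1,\dots,\sigma_{n-1}$ ($\sigma_i$ a positive crossing). The closure $\widehat\beta$ of $\beta\in B_n$ is viewed as an oriented link in the thickened annulus $A\times I\subset S^3$ (unknotted), with all strands oriented parallel (braid orientation). Let $n_\pm$ be the number of positive/negative crossings of a braid word for $\beta$; the writhe is $w(\widehat\beta)=w(\beta)=n_+-n_-$. Lee complex and $d_t$ (over $\mathbb{Q}$): let $V=\mathbb{Q}\langle v_+,v_-\rangle$. For each vertex $v\in\{0,1\}^{\text{crossings}}$ of the cube of resolutions of the diagram $\widehat\beta$, take the complete resolution $D_v$ (a collection of circles in the annulus); the distinguished generators at $v$ are the labelings of the circles of $D_v$ by $+$ or $-$ (i.e. by $v_+$ or $v_-$). A distinguished generator has homological grading $i=|v|-n_-$, quantum grading $j=\#(+)-\#(-)+|v|+n_+-2n_-$, and annular grading $k=\#(+)-\#(-)$ counted only over circles that wrap around the annulus. The Lee differential $\partial+\Phi$ is the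 signed sum over edges of the cube of merge maps $m(v_+\otimes v_+)=v_+$, $m(v_+\otimes v_-)=m(v_-\otimes v_+)=v_-$, $m(v_-\otimes v_-)=v_+$ and split maps $\Delta(v_+)=v_+\otimes v_-+v_-\otimes v_+$, $\Delta(v_-)=v_-\otimes v_-+v_+\otimes v_+$. Its homology is $\mathrm{Lee}(\widehat\beta)$. Let $\mathfrak{s}_o$ be Lee's canonical cycle for the braid orientation $o$: in the oriented resolution ($n$ concentric circles) label the circles alternately by $v_-+v_+$ and $v_--v_+$. For $t\in[0,2]$ put $j_t=j-tk$ on distinguished generators; for a nonzero chain $x$, $j_t(x)$ is the minimum of $j_t$ over the distinguished generators occurring in $x$ with nonzero coefficient. The annular Rasmussen invariant is $d_t(\widehat\beta)=\max\{j_t(x): x\text{ a cycle},\ [x]=[\mathfrak{s}_o]\}$, and the Rasmussen invariant (in the Beliakova–Wehrli extension to oriented links) is $s(\widehat\beta)=d_0(\widehat\beta)+1$. *)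

theory Defs
  imports Complex_Main "HOL-Algebra.Group"
begin

section \<open>Braid groups\<close>

text \<open>The letter \<open>(i, True)\<close> stands for the Artin generator \<open>\<sigma>\<^sub>i\<close> (a positive crossing between the
  strands in positions \<open>i\<close> and \<open>i + 1\<close>), and \<open>(i, False)\<close> for its inverse.\<close>

type_synonym letter = "nat \<times> bool"
type_synonym braid_word = "letter list"

definition braid_words :: "nat \<Rightarrow> braid_word set" where
  "braid_words n = lists ({1..<n} \<times> UNIV)"

inductive braid_equiv :: "nat \<Rightarrow> braid_word \<Rightarrow> braid_word \<Rightarrow> bool" for n :: nat where
  refl: "u \<in> braid_words n \<Longrightarrow> braid_equiv n u u"
| sym: "braid_equiv n u v \<Longrightarrow> braid_equiv n v u"
| trans: "braid_equiv n u v \<Longrightarrow> braid_equiv n v w \<Longrightarrow> braid_equiv n u w"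
| cancel: "u \<in> braid_words n \<Longrightarrow> v \<in> braid_words n \<Longrightarrow> i \<in> {1..<n} \<Longrightarrow>
    braid_equiv n (u @ [(i, b), (i, \<not> b)] @ v) (u @ v)"
| far_commute: "u \<in> braid_words n \<Longrightarrow> v \<in> braid_words n \<Longrightarrow> i \<in> {1..<n} \<Longrightarrow> j \<in> {1..<n} \<Longrightarrow>
    i + 2 \<le> j \<Longrightarrow>
    braid_equiv n (u @ [(i, True), (j, True)] @ v) (u @ [(j, True), (i, True)] @ v)"
| braid: "u \<in> braid_words n \<Longrightarrow> v \<in> braid_words n \<Longrightarrow> i \<in> {1..<n} \<Longrightarrow> i + 1 \<in> {1..<n} \<Longrightarrow>
    braid_equiv n (u @ [(i, True), (i + 1, True), (i, True)] @ v)
                  (u @ [(i + 1, True), (i, True), (i + 1, True)] @ v)"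

definition braid_rel :: "nat \<Rightarrow> (braid_word \<times> braid_word) set" where
  "braid_rel n = {(u, v). braid_equiv n u v}"

text \<open>An element of the braid group is the set of all words that represent it.\<close>

definition braid_group :: "nat \<Rightarrow> braid_word set monoid" where
  "braid_group n =
    \<lparr> carrier = braid_words n // braid_rel n,
      mult = (\<lambda>A B. braid_rel n `` {a @ b | a b. a \<in> A \<and> b \<in> B}),
      one = braid_rel n `` {[]} \<rparr>"

lemma braid_equiv_words: "braid_equiv n u v \<Longrightarrow> u \<in> braid_words n \<and> v \<in> braid_words n"
  by (induction rule: braid_equiv.induct) (auto simp: braid_words_def)

lemma equiv_braid_rel: "equiv (braid_words n) (braid_rel n)"
proof (rule equivI)
  show "braid_rel n \<subseteq> braid_words n \<times> braid_words n"
    using braid_equiv_words by (auto simp: braid_rel_def)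
  show "refl_on (braid_words n) (braid_rel n)"
    by (simp add: braid_rel_def refl_on_def braid_equiv.refl)
  show "sym (braid_rel n)"
    unfolding braid_rel_def sym_def by (simp add: braid_equiv.sym)
  show "trans (braid_rel n)"
    unfolding braid_rel_def trans_def using braid_equiv.trans by simp
qed

lemma braid_equiv_context:
  assumes "braid_equiv n u v" "a \<in> braid_words n" "b \<in> braid_words n"
  shows "braid_equiv n (a @ u @ b) (a @ v @ b)"
  using assms
proof (induction rule: braid_equiv.induct)
  case (refl u)
  then show ?case by (intro braid_equiv.refl) (auto simp: braid_words_def)
next
  case (sym u v)
  then show ?case by (simp add: braid_equiv.sym)
next
  case (trans u v w)
  show ?case using trans.IH[OF trans.prems] by (rule braid_equiv.trans)
next
  case (cancel u v i c)
  then show ?case using braid_equiv.cancel[of "a @ u" n "v @ b" i c] by (auto simp: braid_words_def)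
next
  case (far_commute u v i j)
  then show ?case using braid_equiv.far_commute[of "a @ u" n "v @ b" i j]
    by (auto simp: braid_words_def)
next
  case (braid u v i)
  then show ?case using braid_equiv.braid[of "a @ u" n "v @ b" i] by (auto simp: braid_words_def)
qed

lemma braid_equiv_append:
  assumes "braid_equiv n u u'" "braid_equiv n v v'"
  shows "braid_equiv n (u @ v) (u' @ v')"
proof -
  have "braid_equiv n (u @ v) (u' @ v)"
    using braid_equiv_context[OF assms(1), of "[]" v] braid_equiv_words[OF assms(2)]
    by (simp add: braid_words_def)
  moreover have "braid_equiv n (u' @ v) (u' @ v')"
    using braid_equiv_context[OF assms(2), of u' "[]"] braid_equiv_words[OF assms(1)]
    by (simp add: braid_words_def)
  ultimately show ?thesis by (rule braid_equiv.trans)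
qed

lemma braid_group_mult_class:
  assumes "u \<in> braid_words n" "v \<in> braid_words n"
  shows "braid_rel n `` {u} \<otimes>\<^bsub>braid_group n\<^esub> braid_rel n `` {v} = braid_rel n `` {u @ v}"
proof -
  have "braid_rel n `` {a @ b |a b. a \<in> braid_rel n `` {u} \<and> b \<in> braid_rel n `` {v}}
      = braid_rel n `` {u @ v}"
  proof (intro equalityI subsetI)
    fix x assume "x \<in> braid_rel n `` {a @ b |a b. a \<in> braid_rel n `` {u} \<and> b \<in> braid_rel n `` {v}}"
    then obtain a b where "braid_equiv n u a" "braid_equiv n v b" "braid_equiv n (a @ b) x"
      by (auto simp: braid_rel_def)
    then have "braid_equiv n (u @ v) x"
      using braid_equiv.trans[OF braid_equiv_append] by simp
    then show "x \<in> braid_rel n `` {u @ v}" by (simp add: braid_rel_def)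
  next
    fix x assume "x \<in> braid_rel n `` {u @ v}"
    then show "x \<in> braid_rel n `` {a @ b |a b. a \<in> braid_rel n `` {u} \<and> b \<in> braid_rel n `` {v}}"
      using braid_equiv.refl[OF assms(1)] braid_equiv.refl[OF assms(2)]
      unfolding braid_rel_def by blast
  qed
  then show ?thesis by (simp add: braid_group_def)
qed

lemma braid_words_inverse:
  "u \<in> braid_words n \<Longrightarrow> rev (map (\<lambda>(i, b). (i, \<not> b)) u) \<in> braid_words n"
  by (induction u) (auto simp: braid_words_def)

lemma braid_equiv_inverse:
  "u \<in> braid_words n \<Longrightarrow> braid_equiv n (rev (map (\<lambda>(i, b). (i, \<not> b)) u) @ u) []"
proof (induction u)
  case Nil
  then show ?case by (auto simp: braid_words_def intro: braid_equiv.refl)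
next
  case (Cons l u)
  obtain i b where l: "l = (i, b)" by (cases l)
  have u: "u \<in> braid_words n" "i \<in> {1..<n}" using Cons.prems l by (auto simp: braid_words_def)
  have w: "rev (map (\<lambda>(i, b). (i, \<not> b)) u) \<in> braid_words n"
    by (rule braid_words_inverse[OF u(1)])
  show ?case
    using braid_equiv.trans[OF braid_equiv.cancel[OF w u(1) u(2), of "\<not> b"] Cons.IH[OF u(1)]]
    by (simp add: l)
qed

lemma group_braid_group: "group (braid_group n)"
proof (rule groupI)
  have rep: "\<exists>u \<in> braid_words n. A = braid_rel n `` {u}" if "A \<in> carrier (braid_group n)" for A
    using that by (auto simp: braid_group_def quotient_def)
  have in_carr: "braid_rel n `` {u} \<in> carrier (braid_group n)" if "u \<in> braid_words n" for u
    using that by (auto simp: braid_group_def quotient_def)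
  have nil: "[] \<in> braid_words n" by (simp add: braid_words_def)
  have app: "u @ v \<in> braid_words n" if "u \<in> braid_words n" "v \<in> braid_words n" for u v
    using that by (simp add: braid_words_def)
  have one: "\<one>\<^bsub>braid_group n\<^esub> = braid_rel n `` {[]}" by (simp add: braid_group_def)
  show "A \<otimes>\<^bsub>braid_group n\<^esub> B \<in> carrier (braid_group n)"
    if "A \<in> carrier (braid_group n)" "B \<in> carrier (braid_group n)" for A B
    using rep[OF that(1)] rep[OF that(2)] braid_group_mult_class in_carr app
    by metis
  show "\<one>\<^bsub>braid_group n\<^esub> \<in> carrier (braid_group n)"
    unfolding one by (rule in_carr[OF nil])
  show "A \<otimes>\<^bsub>braid_group n\<^esub> B \<otimes>\<^bsub>braid_group n\<^esub> C = A \<otimes>\<^bsub>braid_group n\<^esub> (B \<otimes>\<^bsub>braid_group n\<^esub> C)"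
    if "A \<in> carrier (braid_group n)" "B \<in> carrier (braid_group n)" "C \<in> carrier (braid_group n)"
    for A B C
    using rep[OF that(1)] rep[OF that(2)] rep[OF that(3)] by (auto simp: braid_group_mult_class app)
  show "\<one>\<^bsub>braid_group n\<^esub> \<otimes>\<^bsub>braid_group n\<^esub> A = A" if "A \<in> carrier (braid_group n)" for A
    using rep[OF that] by (auto simp: one braid_group_mult_class nil)
  show "\<exists>B \<in> carrier (braid_group n). B \<otimes>\<^bsub>braid_group n\<^esub> A = \<one>\<^bsub>braid_group n\<^esub>"
    if A: "A \<in> carrier (braid_group n)" for A
  proof -
    obtain u where u: "u \<in> braid_words n" "A = braid_rel n `` {u}" using rep[OF A] by blast
    define u' where "u' = rev (map (\<lambda>(i, b). (i, \<not> b)) u)"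
    have u': "u' \<in> braid_words n" unfolding u'_def by (rule braid_words_inverse[OF u(1)])
    have "braid_rel n `` {u' @ u} = braid_rel n `` {[]}"
      using braid_equiv_inverse[OF u(1)] equiv_class_eq[OF equiv_braid_rel]
      by (auto simp: u'_def braid_rel_def)
    then show ?thesis
      using u u' in_carr by (auto simp: one braid_group_mult_class intro!: bexI[of _ "braid_rel n `` {u'}"])
  qed
qed

definition n_plus :: "braid_word \<Rightarrow> nat" where
  "n_plus w = length (filter snd w)"

definition n_minus :: "braid_word \<Rightarrow> nat" where
  "n_minus w = length (filter (\<lambda>l. \<not> snd l) w)"

definition writhe :: "braid_word \<Rightarrow> int" where
  "writhe w = int (n_plus w) - int (n_minus w)"

section \<open>The cube of resolutions of a braid closure\<close>

text \<open>The closure of the word \<open>w\<close> on \<open>n\<close> strands has the crossings \<open>c < length w\<close>. The point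
  \<open>(l, p)\<close> is the strand position \<open>p \<in> {1..n}\<close> at level \<open>l \<in> {0..length w}\<close>; crossing \<open>c\<close> lies between
  the levels \<open>c\<close> and \<open>c + 1\<close>, and closing up joins \<open>(length w, p)\<close> to \<open>(0, p)\<close>. A vertex of the cube is
  the set of crossings that receive the 1-resolution. The 0-resolution of a positive crossing
  and the 1-resolution of a negative crossing are the oriented ones.\<close>

type_synonym point = "nat \<times> nat"
type_synonym circle = "point set"
type_synonym vertex = "nat set"

definition vertices :: "braid_word \<Rightarrow> vertex set" where
  "vertices w = Pow {..<length w}"

definition points :: "nat \<Rightarrow> braid_word \<Rightarrow> point set" where
  "points n w = {0..length w} \<times> {1..n}"

definition oriented_at :: "braid_word \<Rightarrow> vertex \<Rightarrow> nat \<Rightarrow> bool" where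
  "oriented_at w v c \<longleftrightarrow> (if snd (w ! c) then c \<notin> v else c \<in> v)"

definition crossing_arcs :: "nat \<Rightarrow> braid_word \<Rightarrow> vertex \<Rightarrow> nat \<Rightarrow> (point \<times> point) set" where
  "crossing_arcs n w v c =
    (let i = fst (w ! c) in
      (if oriented_at w v c
       then {((c, p), (c + 1, p)) | p. p \<in> {1..n}}
       else {((c, p), (c + 1, p)) | p. p \<in> {1..n} - {i, i + 1}} \<union>
            {((c, i), (c, i + 1)), ((c + 1, i), (c + 1, i + 1))}))"

definition closure_arcs :: "nat \<Rightarrow> braid_word \<Rightarrow> (point \<times> point) set" where
  "closure_arcs n w = {((length w, p), (0, p)) | p. p \<in> {1..n}}"

definition arcs :: "nat \<Rightarrow> braid_word \<Rightarrow> vertex \<Rightarrow> (point \<times> point) set" where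
  "arcs n w v = closure_arcs n w \<union> (\<Union>c<length w. crossing_arcs n w v c)"

text \<open>A circle of the complete resolution is recorded as the set of points it passes through.\<close>

definition circles :: "nat \<Rightarrow> braid_word \<Rightarrow> vertex \<Rightarrow> circle set" where
  "circles n w v = points n w // (arcs n w v \<union> (arcs n w v)\<inverse>)\<^sup>*"

text \<open>The points at level 0 are the intersections with an arc joining the two boundary circles of the
  annulus. An embedded circle wraps around the annulus iff it separates the two boundary circles,
  i.e. iff it meets that arc an odd number of times.\<close>

definition wraps :: "circle \<Rightarrow> bool" where
  "wraps C \<longleftrightarrow> odd (card {p. (0, p) \<in> C})"

section \<open>The Lee complex\<close>

datatype label = Plus | Minus

type_synonym gen = "vertex \<times> (circle \<Rightarrow> label)"
type_synonym chain = "gen \<Rightarrow> rat"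

definition gens :: "nat \<Rightarrow> braid_word \<Rightarrow> gen set" where
  "gens n w = (SIGMA v : vertices w. circles n w v \<rightarrow>\<^sub>E UNIV)"

definition label_val :: "label \<Rightarrow> int" where
  "label_val a = (case a of Plus \<Rightarrow> 1 | Minus \<Rightarrow> - 1)"

definition quantum_grading :: "nat \<Rightarrow> braid_word \<Rightarrow> gen \<Rightarrow> int" where
  "quantum_grading n w = (\<lambda>(v, L).
    (\<Sum>C \<in> circles n w v. label_val (L C)) + int (card v) + int (n_plus w) - 2 * int (n_minus w))"

definition annular_grading :: "nat \<Rightarrow> braid_word \<Rightarrow> gen \<Rightarrow> int" where
  "annular_grading n w = (\<lambda>(v, L). \<Sum>C \<in> {C \<in> circles n w v. wraps C}. label_val (L C))"

definition j_gen :: "nat \<Rightarrow> braid_word \<Rightarrow> real \<Rightarrow> gen \<Rightarrow> real" where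
  "j_gen n w t g = of_int (quantum_grading n w g) - t * of_int (annular_grading n w g)"

text \<open>\<open>(a, b, c) \<in> merge_terms\<close> iff \<open>v\<^sub>c\<close> occurs in \<open>m(v\<^sub>a \<otimes> v\<^sub>b)\<close>, and \<open>(a, b, c) \<in> split_terms\<close> iff
  \<open>v\<^sub>b \<otimes> v\<^sub>c\<close> occurs in \<open>\<Delta>(v\<^sub>a)\<close>; all these coefficients are 1.\<close>

definition merge_terms :: "(label \<times> label \<times> label) set" where
  "merge_terms = {(Plus, Plus, Plus), (Plus, Minus, Minus), (Minus, Plus, Minus), (Minus, Minus, Plus)}"

definition split_terms :: "(label \<times> label \<times> label) set" where
  "split_terms = {(Plus, Plus, Minus), (Plus, Minus, Plus), (Minus, Minus, Minus), (Minus, Plus, Plus)}"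

definition edge_term :: "nat \<Rightarrow> braid_word \<Rightarrow> gen \<Rightarrow> gen \<Rightarrow> bool" where
  "edge_term n w = (\<lambda>(v, L) (v', L').
    (\<forall>C \<in> circles n w v \<inter> circles n w v'. L' C = L C) \<and>
    ((\<exists>A B C. A \<noteq> B \<and> circles n w v - circles n w v' = {A, B} \<and>
        circles n w v' - circles n w v = {C} \<and> (L A, L B, L' C) \<in> merge_terms) \<or>
     (\<exists>A B C. B \<noteq> C \<and> circles n w v - circles n w v' = {A} \<and>
        circles n w v' - circles n w v = {B, C} \<and> (L A, L' B, L' C) \<in> split_terms)))"

text \<open>The edge from \<open>v\<close> to \<open>insert c v\<close> carries the standard sign given by the number of
  1-resolved crossings that precede \<open>c\<close>.\<close>

definition lee_coeff :: "nat \<Rightarrow> braid_word \<Rightarrow> gen \<Rightarrow> gen \<Rightarrow> rat" where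
  "lee_coeff n w g g' =
    (\<Sum>c | c < length w \<and> c \<notin> fst g \<and> fst g' = insert c (fst g) \<and> edge_term n w g g'.
      (- 1) ^ card {c' \<in> fst g. c' < c})"

definition chains :: "nat \<Rightarrow> braid_word \<Rightarrow> chain set" where
  "chains n w = {x. \<forall>g. g \<notin> gens n w \<longrightarrow> x g = 0}"

definition lee_diff :: "nat \<Rightarrow> braid_word \<Rightarrow> chain \<Rightarrow> chain" where
  "lee_diff n w x = (\<lambda>g'. if g' \<in> gens n w then \<Sum>g \<in> gens n w. lee_coeff n w g g' * x g else 0)"

definition lee_cycles :: "nat \<Rightarrow> braid_word \<Rightarrow> chain set" where
  "lee_cycles n w = {x \<in> chains n w. lee_diff n w x = (\<lambda>_. 0)}"

definition homologous :: "nat \<Rightarrow> braid_word \<Rightarrow> chain \<Rightarrow> chain \<Rightarrow> bool" where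
  "homologous n w x y \<longleftrightarrow> (\<exists>z \<in> chains n w. (\<lambda>g. x g - y g) = lee_diff n w z)"

section \<open>The annular Rasmussen invariant\<close>

definition oriented_vertex :: "braid_word \<Rightarrow> vertex" where
  "oriented_vertex w = {c. c < length w \<and> \<not> snd (w ! c)}"

definition strand_circle :: "braid_word \<Rightarrow> nat \<Rightarrow> circle" where
  "strand_circle w p = {0..length w} \<times> {p}"

text \<open>The circles of the oriented resolution are the \<open>strand_circle w p\<close> for \<open>p \<in> {1..n}\<close>. They are
  labelled by \<open>v\<^sub>- + v\<^sub>+\<close> for odd \<open>p\<close> and by \<open>v\<^sub>- - v\<^sub>+\<close> for even \<open>p\<close>; \<open>lee_canonical\<close> lists the coefficients of
  the expanded tensor product.\<close>

definition canonical_label_coeff :: "nat \<Rightarrow> label \<Rightarrow> rat" where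
  "canonical_label_coeff p a = (case a of Minus \<Rightarrow> 1 | Plus \<Rightarrow> (if odd p then 1 else - 1))"

definition lee_canonical :: "nat \<Rightarrow> braid_word \<Rightarrow> chain" where
  "lee_canonical n w = (\<lambda>(v, L).
    if (v, L) \<in> gens n w \<and> v = oriented_vertex w
    then \<Prod>p \<in> {1..n}. canonical_label_coeff p (L (strand_circle w p))
    else 0)"

definition j_chain :: "nat \<Rightarrow> braid_word \<Rightarrow> real \<Rightarrow> chain \<Rightarrow> real" where
  "j_chain n w t x = Min {j_gen n w t g | g. g \<in> gens n w \<and> x g \<noteq> 0}"

definition annular_rasmussen :: "nat \<Rightarrow> braid_word \<Rightarrow> real \<Rightarrow> real" where
  "annular_rasmussen n w t =
    Max {j_chain n w t x | x. x \<in> lee_cycles n w \<and> x \<noteq> (\<lambda>_. 0) \<and> homologous n w x (lee_canonical n w)}"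

definition rasmussen_s :: "nat \<Rightarrow> braid_word \<Rightarrow> real" where
  "rasmussen_s n w = annular_rasmussen n w 0 + 1"

end

theory Submission
  imports Defs
begin

text \<open>Generators at the oriented vertex have \<open>j = w + k\<close> with \<open>k \<in> {-3, -1, 1, 3}\<close>, and every other
  resolution of a 3-braid closure has at most one wrapping circle, so \<open>\<bar>k\<bar> \<le> 1\<close> there. The Lee differential
  preserves \<open>j\<close> modulo 4, so the canonical cycle is the sum of its parts with \<open>j \<equiv> w + 1\<close> and
  \<open>j \<equiv> w - 1\<close> modulo 4. The canonical cycle is also a cocycle for the dual basis; pairing with its
  part \<open>j \<equiv> w + 1\<close> shows that every representative contains an oriented generator with \<open>k = 1\<close> or
  \<open>k = -3\<close>, whence \<open>d\<^sub>t \<le> w + 1 - t\<close>, and the canonical cycle itself gives \<open>d\<^sub>t \<ge> w - 3 + 3t\<close>. The three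
  cases correspond to the best lower bound \<open>w - 3\<close>, \<open>w - 1\<close> or \<open>w + 1\<close> for \<open>j\<close> on a representative. In the
  middle case, replacing the part \<open>j \<equiv> w - 1\<close> of a representative by that of the canonical cycle makes
  it optimal for all \<open>t\<close> simultaneously.\<close>

section \<open>Circles of a resolution\<close>

lemma UNIV_label: "(UNIV :: label set) = {Plus, Minus}"
  using label.exhaust by auto

lemma finite_circles: "finite (circles n w v)"
  by (simp add: circles_def quotient_def points_def)

lemma finite_gens: "finite (gens n w)"
  unfolding gens_def vertices_def
  by (intro finite_SigmaI finite_PiE) (auto simp: finite_circles UNIV_label)

lemma circle_point: "C \<in> circles n w v \<Longrightarrow> \<exists>a \<in> points n w. C = (arcs n w v \<union> (arcs n w v)\<inverse>)\<^sup>* `` {a}"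
  by (auto simp: circles_def quotient_def)

lemma sym_arc_closure: "((arcs n w v \<union> (arcs n w v)\<inverse>)\<^sup>*)\<inverse> = (arcs n w v \<union> (arcs n w v)\<inverse>)\<^sup>*"
  by (metis Un_commute converse_Un converse_converse rtrancl_converse)

lemma circle_closed:
  assumes "C \<in> circles n w v" "(a, b) \<in> arcs n w v"
  shows "a \<in> C \<longleftrightarrow> b \<in> C"
proof -
  obtain x where C: "C = (arcs n w v \<union> (arcs n w v)\<inverse>)\<^sup>* `` {x}"
    using circle_point[OF assms(1)] by auto
  show ?thesis
    unfolding C using assms(2) by (auto intro: rtrancl_into_rtrancl)
qed

lemma circle_disjoint:
  assumes "C \<in> circles n w v" "D \<in> circles n w v" "a \<in> C" "a \<in> D"
  shows "C = D"
proof -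
  let ?R = "(arcs n w v \<union> (arcs n w v)\<inverse>)\<^sup>*"
  obtain x y where C: "C = ?R `` {x}" and D: "D = ?R `` {y}"
    using circle_point[OF assms(1)] circle_point[OF assms(2)] by auto
  have "(x, a) \<in> ?R" "(y, a) \<in> ?R" using assms(3,4) C D by auto
  then have "(a, x) \<in> ?R" "(a, y) \<in> ?R"
    using sym_arc_closure[of n w v] by blast+
  with \<open>(x, a) \<in> ?R\<close> \<open>(y, a) \<in> ?R\<close> have "(x, y) \<in> ?R" "(y, x) \<in> ?R"
    by (meson rtrancl_trans)+
  then show ?thesis unfolding C D by (auto intro: rtrancl_trans)
qed

lemma braid_word_nth:
  assumes "w \<in> braid_words n" "c < length w"
  shows "1 \<le> fst (w ! c)" "fst (w ! c) + 1 \<le> n"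
proof -
  have "w ! c \<in> {1..<n} \<times> UNIV"
    using assms nth_mem[OF assms(2)] by (auto simp: braid_words_def in_lists_conv_set)
  then show "1 \<le> fst (w ! c)" "fst (w ! c) + 1 \<le> n" by auto
qed

lemma arcs_points:
  assumes "w \<in> braid_words n" "(a, b) \<in> arcs n w v"
  shows "a \<in> points n w" "b \<in> points n w"
  using assms(2) braid_word_nth[OF assms(1)]
  by (auto simp: arcs_def closure_arcs_def crossing_arcs_def Let_def points_def split: if_splits)
    (fastforce)+

lemma circle_subset_points:
  assumes "w \<in> braid_words n" "C \<in> circles n w v"
  shows "C \<subseteq> points n w"
proof
  fix y assume "y \<in> C"
  obtain x where x: "x \<in> points n w" "C = (arcs n w v \<union> (arcs n w v)\<inverse>)\<^sup>* `` {x}"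
    using circle_point[OF assms(2)] by auto
  then have "(x, y) \<in> (arcs n w v \<union> (arcs n w v)\<inverse>)\<^sup>*" using \<open>y \<in> C\<close> by auto
  then show "y \<in> points n w"
    by (induction rule: rtrancl_induct) (use x arcs_points[OF assms(1)] in auto)
qed

section \<open>Parity of the intersection of a circle with the levels\<close>

lemma oriented_arc:
  assumes "c < length w" "oriented_at w v c" "p \<in> {1..n}"
  shows "((c, p), (c + 1, p)) \<in> arcs n w v"
proof -
  have "((c, p), (c + 1, p)) \<in> crossing_arcs n w v c"
    using assms(2,3) by (simp add: crossing_arcs_def)
  then show ?thesis using assms(1) by (auto simp: arcs_def)
qed

lemma unoriented_arcs:
  assumes "c < length w" "\<not> oriented_at w v c"
  shows "((c, fst (w ! c)), (c, fst (w ! c) + 1)) \<in> arcs n w v"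
    "((c + 1, fst (w ! c)), (c + 1, fst (w ! c) + 1)) \<in> arcs n w v"
    "p \<in> {1..n} - {fst (w ! c), fst (w ! c) + 1} \<Longrightarrow> ((c, p), (c + 1, p)) \<in> arcs n w v"
  using assms by (fastforce simp: arcs_def crossing_arcs_def Let_def)+

text \<open>At an oriented crossing the circle meets both levels in the same positions. At any other
  crossing each of the two turning arcs joins positions \<open>i\<close> and \<open>i + 1\<close>,
  so these contribute 0 or 2 at either level, while the remaining positions pass straight
  through.\<close>

lemma odd_level_step:
  assumes w: "w \<in> braid_words n" and C: "C \<in> circles n w v" and c: "c < length w"
  shows "odd (card {p. (c + 1, p) \<in> C}) \<longleftrightarrow> odd (card {p. (c, p) \<in> C})"
proof (cases "oriented_at w v c")
  case True
  have "{p. (c + 1, p) \<in> C} = {p. (c, p) \<in> C}"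
    using circle_subset_points[OF w C] circle_closed[OF C oriented_arc[OF c True]]
    by (auto simp: points_def)
  then show ?thesis by simp
next
  case False
  let ?i = "fst (w ! c)"
  let ?X = "\<lambda>l. {p \<in> {1..n} - {?i, ?i + 1}. (l, p) \<in> C}"
  have i: "1 \<le> ?i" "?i + 1 \<le> n" by (rule braid_word_nth[OF w c])+
  have level: "odd (card {p. (l, p) \<in> C}) \<longleftrightarrow> odd (card (?X l))"
    if "(l, ?i) \<in> C \<longleftrightarrow> (l, ?i + 1) \<in> C" for l
  proof (cases "(l, ?i) \<in> C")
    case True
    have "{p. (l, p) \<in> C} = insert ?i (insert (?i + 1) (?X l))"
      using True that circle_subset_points[OF w C] by (auto simp: points_def)
    then show ?thesis by simp
  next
    case False
    have "{p. (l, p) \<in> C} = ?X l"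
      using False that circle_subset_points[OF w C] by (auto simp: points_def)
    then show ?thesis by simp
  qed
  have "?X (c + 1) = ?X c"
    using circle_closed[OF C unoriented_arcs(3)[OF c False]] by auto
  then show ?thesis
    using level[of c] level[of "c + 1"] circle_closed[OF C unoriented_arcs(1)[OF c False]]
      circle_closed[OF C unoriented_arcs(2)[OF c False]] by simp
qed

text \<open>Carries the parity test for \<open>wraps\<close>, which is defined at level 0, to the
  level of any crossing.\<close>

lemma odd_level_iff_wraps:
  assumes "w \<in> braid_words n" "C \<in> circles n w v" "c \<le> length w"
  shows "odd (card {p. (c, p) \<in> C}) \<longleftrightarrow> wraps C"
  using assms(3)
proof (induction c)
  case 0
  then show ?case by (simp add: wraps_def)
next
  case (Suc c)
  then show ?case using odd_level_step[OF assms(1,2), of c] by simp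
qed

lemma not_oriented_vertex:
  assumes "v \<in> vertices w" "v \<noteq> oriented_vertex w"
  shows "\<exists>c < length w. \<not> oriented_at w v c"
  using assms by (fastforce simp: vertices_def oriented_vertex_def oriented_at_def split: if_splits)

lemma oriented_at_oriented_vertex: "c < length w \<Longrightarrow> oriented_at w (oriented_vertex w) c"
  by (simp add: oriented_at_def oriented_vertex_def)

text \<open>This is where three strands matter: at an unoriented crossing only one position is left
  besides \<open>i\<close> and \<open>i + 1\<close>, and distinct circles cannot share it.\<close>

lemma wrapping_circle_unique:
  assumes w: "w \<in> braid_words 3" and v: "v \<in> vertices w" "v \<noteq> oriented_vertex w"
    and C: "C \<in> circles 3 w v" "wraps C" and D: "D \<in> circles 3 w v" "wraps D"
  shows "C = D"
proof -
  obtain c where c: "c < length w" "\<not> oriented_at w v c"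
    using not_oriented_vertex[OF v] by auto
  define i where "i = fst (w ! c)"
  have i: "1 \<le> i" "i + 1 \<le> 3" unfolding i_def by (rule braid_word_nth[OF w c(1)])+
  have "i = 1 \<or> i = 2" using i by auto
  then have "{1..3} = {i, i + 1, if i = 1 then 3 else 1}" by auto
  then obtain q where q: "{1..3} = {i, i + 1, q}" by blast
  \<comment> \<open>\<open>i\<close> and \<open>i + 1\<close> lie on the same circle at level \<open>c\<close>, so odd parity there forces the third point.\<close>
  have third: "(c, q) \<in> E" if E: "E \<in> circles 3 w v" "wraps E" for E
  proof (rule ccontr)
    assume nq: "(c, q) \<notin> E"
    have same: "(c, i) \<in> E \<longleftrightarrow> (c, i + 1) \<in> E"
      unfolding i_def by (rule circle_closed[OF E(1) unoriented_arcs(1)[OF c]])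
    have sub: "{p. (c, p) \<in> E} \<subseteq> {i, i + 1, q}"
      using circle_subset_points[OF w E(1)] q(1) by (auto simp: points_def)
    have "{p. (c, p) \<in> E} = (if (c, i) \<in> E then {i, i + 1} else {})"
      using sub same nq by auto
    then have "even (card {p. (c, p) \<in> E})" by simp
    then show False using odd_level_iff_wraps[OF w E(1)] c(1) E(2) by simp
  qed
  show ?thesis using circle_disjoint[OF C(1) D(1) third[OF C] third[OF D]] .
qed

section \<open>The circles of the oriented resolution\<close>

lemma strand_circle_inject [simp]: "strand_circle w p = strand_circle w q \<longleftrightarrow> p = q"
  by (auto simp: strand_circle_def times_eq_iff)

text \<open>No arc of the oriented resolution changes the position, and the crossing arcs alone
  already join all the levels at one position.\<close>

lemma circles_oriented: "circles n w (oriented_vertex w) = strand_circle w ` {1..n}"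
proof -
  let ?A = "arcs n w (oriented_vertex w)"
  let ?R = "(?A \<union> ?A\<inverse>)\<^sup>*"
  have base: "((0, p), (l, p)) \<in> ?R" if "l \<le> length w" "p \<in> {1..n}" for l p
    using that(1)
  proof (induction l)
    case (Suc l)
    then have "((l, p), (l + 1, p)) \<in> ?A"
      using oriented_arc[OF _ oriented_at_oriented_vertex that(2)] by simp
    then show ?case using Suc by (auto intro: rtrancl_into_rtrancl)
  qed simp
  have "?R `` {(l, p)} = strand_circle w p" if lp: "l \<le> length w" "p \<in> {1..n}" for l p
  proof (intro equalityI subsetI)
    fix y assume "y \<in> ?R `` {(l, p)}"
    then have "((l, p), y) \<in> ?R" by simp
    then show "y \<in> strand_circle w p"
    proof (induction rule: rtrancl_induct)
      case base
      then show ?case using lp by (simp add: strand_circle_def)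
    next
      case (step y z)
      from step(2,3) show ?case
        using oriented_at_oriented_vertex[of _ w]
        by (auto simp: strand_circle_def arcs_def closure_arcs_def crossing_arcs_def)
    qed
  next
    fix y assume "y \<in> strand_circle w p"
    then obtain l' where y: "y = (l', p)" "l' \<le> length w" by (auto simp: strand_circle_def)
    have "((l, p), (0, p)) \<in> ?R"
      using base[OF lp] sym_arc_closure[of n w "oriented_vertex w"] by blast
    then have "((l, p), y) \<in> ?R" using base[OF y(2) lp(2)] y(1) by (auto intro: rtrancl_trans)
    then show "y \<in> ?R `` {(l, p)}" by simp
  qed
  then have "circles n w (oriented_vertex w) = (\<Union>x \<in> points n w. {strand_circle w (snd x)})"
    unfolding circles_def quotient_def by (auto simp: points_def)
  also have "\<dots> = strand_circle w ` {1..n}"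
    by (auto simp: points_def)
  finally show ?thesis .
qed

text \<open>A circle through \<open>(c, i)\<close> also passes through \<open>(c, i + 1)\<close>,
  whereas a strand circle stays in one position. Hence both strand circles disappear or appear along
  an edge at the oriented vertex that changes crossing \<open>c\<close>.\<close>

lemma unoriented_strand_not_circle:
  assumes "c < length w" "\<not> oriented_at w v c"
  shows "strand_circle w (fst (w ! c)) \<notin> circles n w v"
    "strand_circle w (fst (w ! c) + 1) \<notin> circles n w v"
proof -
  let ?i = "fst (w ! c)"
  have "(c, ?i) \<in> C \<longleftrightarrow> (c, ?i + 1) \<in> C" if "C \<in> circles n w v" for C
    by (rule circle_closed[OF that unoriented_arcs(1)[OF assms]])
  from this[of "strand_circle w ?i"] this[of "strand_circle w (?i + 1)"]
  show "strand_circle w ?i \<notin> circles n w v" "strand_circle w (?i + 1) \<notin> circles n w v"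
    using assms(1) by (auto simp: strand_circle_def)
qed

section \<open>Gradings\<close>

lemma annular_grading_unoriented:
  assumes "w \<in> braid_words 3" "(v, L) \<in> gens 3 w" "v \<noteq> oriented_vertex w"
  shows "\<bar>annular_grading 3 w (v, L)\<bar> \<le> 1"
proof -
  let ?S = "{C \<in> circles 3 w v. wraps C}"
  have v: "v \<in> vertices w" using assms(2) by (simp add: gens_def)
  have "?S = {} \<or> (\<exists>C. ?S = {C})"
    using wrapping_circle_unique[OF assms(1) v assms(3)] by blast
  then show ?thesis
  proof (elim disjE exE)
    assume "?S = {}"
    then show ?thesis unfolding annular_grading_def prod.case by (simp only: sum.empty abs_zero zero_le_one)
  next
    fix C assume "?S = {C}"
    then show ?thesis
      unfolding annular_grading_def prod.case by (simp add: label_val_def split: label.splits)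
  qed
qed

lemma card_oriented_vertex: "card (oriented_vertex w) = n_minus w"
  by (simp add: oriented_vertex_def n_minus_def length_filter_conv_card)

lemma oriented_vertex_vertices: "oriented_vertex w \<in> vertices w"
  by (auto simp: oriented_vertex_def vertices_def)

lemma annular_grading_oriented:
  "annular_grading n w (oriented_vertex w, L) = (\<Sum>p \<in> {1..n}. label_val (L (strand_circle w p)))"
proof -
  have "{C \<in> circles n w (oriented_vertex w). wraps C} = strand_circle w ` {1..n}"
    by (auto simp: circles_oriented wraps_def strand_circle_def)
  then show ?thesis
    by (simp add: annular_grading_def sum.reindex inj_on_def)
qed

text \<open>All circles of the oriented resolution wrap around the annulus, so their labels sum to
  k; the shifts add up to the writhe because the vertex has \<open>n_minus w\<close>
  elements.\<close>

lemma quantum_grading_oriented: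
  "quantum_grading n w (oriented_vertex w, L) = writhe w + annular_grading n w (oriented_vertex w, L)"
  by (simp add: quantum_grading_def annular_grading_oriented circles_oriented sum.reindex inj_on_def
      card_oriented_vertex writhe_def)

lemma annular_grading_oriented_3:
  "annular_grading 3 w (oriented_vertex w, L) \<in> {-3, -1, 1, 3}"
proof -
  have "{1..3} = {1, 2, 3::nat}" by auto
  then show ?thesis
    unfolding annular_grading_oriented by (simp add: label_val_def split: label.splits)
qed

text \<open>Along an edge the label sum changes by -1 for the terms of the Khovanov differential and
  by 3 for the terms that Lee adds; the additional 1-resolved crossing turns this into 0 or
  4.\<close>

lemma edge_term_quantum_grading:
  assumes e: "edge_term n w (v, L) (insert c v, L')" and v: "c \<notin> v" "finite v"
  shows "quantum_grading n w (insert c v, L') - quantum_grading n w (v, L) \<in> {0, 4}"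
proof -
  let ?P = "circles n w v" and ?Q = "circles n w (insert c v)"
  have split: "(\<Sum>C \<in> ?P. label_val (L C)) = (\<Sum>C \<in> ?P \<inter> ?Q. label_val (L C)) + (\<Sum>C \<in> ?P - ?Q. label_val (L C))"
    "(\<Sum>C \<in> ?Q. label_val (L' C)) = (\<Sum>C \<in> ?P \<inter> ?Q. label_val (L' C)) + (\<Sum>C \<in> ?Q - ?P. label_val (L' C))"
    using sum.Int_Diff[OF finite_circles, of "\<lambda>C. label_val (L C)" n w v ?Q]
      sum.Int_Diff[OF finite_circles, of "\<lambda>C. label_val (L' C)" n w "insert c v" ?P]
    by (simp_all only: Int_commute)
  have same: "(\<Sum>C \<in> ?P \<inter> ?Q. label_val (L' C)) = (\<Sum>C \<in> ?P \<inter> ?Q. label_val (L C))"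
    using e by (intro sum.cong) (auto simp: edge_term_def)
  have "(\<Sum>C \<in> ?Q - ?P. label_val (L' C)) - (\<Sum>C \<in> ?P - ?Q. label_val (L C)) \<in> {-1, 3}"
    using conjunct2[OF e[unfolded edge_term_def prod.case]]
  proof (elim disjE exE conjE)
    fix A B C
    assume "A \<noteq> B" "?P - ?Q = {A, B}" "?Q - ?P = {C}" "(L A, L B, L' C) \<in> merge_terms"
    then show ?thesis by (simp only:) (auto simp: label_val_def merge_terms_def)
  next
    fix A B C
    assume "B \<noteq> C" "?P - ?Q = {A}" "?Q - ?P = {B, C}" "(L A, L' B, L' C) \<in> split_terms"
    then show ?thesis by (simp only:) (auto simp: label_val_def split_terms_def)
  qed
  then show ?thesis using v split same by (auto simp: quantum_grading_def)
qed

lemma lee_coeff_nonzero: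
  assumes "lee_coeff n w g g' \<noteq> 0"
  shows "\<exists>c < length w. c \<notin> fst g \<and> fst g' = insert c (fst g) \<and> edge_term n w g g'"
  using sum.not_neutral_contains_not_neutral[OF assms[unfolded lee_coeff_def]] by auto

lemma lee_coeff_quantum_grading:
  assumes "lee_coeff n w g g' \<noteq> 0" "g \<in> gens n w"
  shows "quantum_grading n w g' mod 4 = quantum_grading n w g mod 4"
proof -
  obtain c where c: "c \<notin> fst g" "fst g' = insert c (fst g)" "edge_term n w g g'"
    using lee_coeff_nonzero[OF assms(1)] by auto
  have "finite (fst g)"
    using assms(2) finite_subset[OF _ finite_lessThan] by (auto simp: gens_def vertices_def)
  then have "quantum_grading n w g' - quantum_grading n w g \<in> {0, 4}"
    using edge_term_quantum_grading[of n w "fst g" "snd g" c "snd g'"] c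
    by (metis prod.collapse)
  then have "quantum_grading n w g' = quantum_grading n w g \<or> quantum_grading n w g' = quantum_grading n w g + 4"
    by auto
  then show ?thesis by auto
qed

section \<open>Splitting the complex by the quantum grading modulo 4\<close>

text \<open>A set of residues is used so that one projection serves three purposes: a singleton
  picks one residue class, a pair of residues differing by 2 keeps a parity class, and
  \<open>UNIV\<close> keeps the whole chain.\<close>

definition quantum_part :: "nat \<Rightarrow> braid_word \<Rightarrow> int set \<Rightarrow> chain \<Rightarrow> chain" where
  "quantum_part n w R x = (\<lambda>g. if quantum_grading n w g mod 4 \<in> R then x g else 0)"

lemma quantum_part_chains: "x \<in> chains n w \<Longrightarrow> quantum_part n w R x \<in> chains n w"
  by (simp add: quantum_part_def chains_def)

text \<open>Nonzero matrix entries of the differential only join generators in the same residue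
  class, so the projection is a chain map.\<close>

lemma lee_diff_quantum_part:
  "lee_diff n w (quantum_part n w R x) = quantum_part n w R (lee_diff n w x)"
proof
  fix g'
  have "lee_coeff n w g g' * quantum_part n w R x g =
      (if quantum_grading n w g' mod 4 \<in> R then lee_coeff n w g g' * x g else 0)"
    if "g \<in> gens n w" for g
    using lee_coeff_quantum_grading[OF _ that, of g']
    by (cases "lee_coeff n w g g' = 0") (auto simp: quantum_part_def)
  then show "lee_diff n w (quantum_part n w R x) g' = quantum_part n w R (lee_diff n w x) g'"
    by (simp add: lee_diff_def quantum_part_def)
qed

lemma quantum_part_cycle: "x \<in> lee_cycles n w \<Longrightarrow> quantum_part n w R x \<in> lee_cycles n w"
  by (simp add: lee_cycles_def quantum_part_chains lee_diff_quantum_part)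
    (simp add: quantum_part_def)

lemma homologous_quantum_part:
  assumes "homologous n w x y"
  shows "homologous n w (quantum_part n w R x) (quantum_part n w R y)"
proof -
  obtain z where z: "z \<in> chains n w" "(\<lambda>g. x g - y g) = lee_diff n w z"
    using assms by (auto simp: homologous_def)
  have "(\<lambda>g. quantum_part n w R x g - quantum_part n w R y g) = lee_diff n w (quantum_part n w R z)"
    unfolding lee_diff_quantum_part z(2)[symmetric] by (auto simp: quantum_part_def)
  then show ?thesis using quantum_part_chains[OF z(1)] by (auto simp: homologous_def)
qed

lemma lee_diff_add:
  "lee_diff n w (\<lambda>g. x g + y g) = (\<lambda>g. lee_diff n w x g + lee_diff n w y g)"
  by (auto simp: lee_diff_def distrib_left sum.distrib)

lemma lee_cycles_add:
  "x \<in> lee_cycles n w \<Longrightarrow> y \<in> lee_cycles n w \<Longrightarrow> (\<lambda>g. x g + y g) \<in> lee_cycles n w"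
  by (simp add: lee_cycles_def lee_diff_add chains_def)

lemma homologous_add:
  assumes "homologous n w x y"
  shows "homologous n w (\<lambda>g. x g + u g) (\<lambda>g. y g + u g)"
  using assms by (simp add: homologous_def)

section \<open>The canonical cycle\<close>

text \<open>This is multiplication by v_- in Lee's algebra, an involution because v_+ is the unit
  and m(v_- \<otimes> v_-) = v_+.\<close>

fun flip_label :: "label \<Rightarrow> label" where
  "flip_label Plus = Minus"
| "flip_label Minus = Plus"

lemma flip_label_flip_label [simp]: "flip_label (flip_label a) = a"
  by (cases a) auto

definition flip_at :: "circle \<Rightarrow> circle \<Rightarrow> gen \<Rightarrow> gen" where
  "flip_at A B = (\<lambda>(v, L). (v, L(A := flip_label (L A), B := flip_label (L B))))"

lemma fst_flip_at [simp]: "fst (flip_at A B g) = fst g"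
  by (cases g) (simp add: flip_at_def)

lemma flip_at_flip_at: "A \<noteq> B \<Longrightarrow> flip_at A B (flip_at A B g) = g"
  by (cases g) (simp add: flip_at_def fun_upd_twist)

lemma flip_at_gens:
  assumes "g \<in> gens n w" "A \<in> circles n w (fst g)" "B \<in> circles n w (fst g)"
  shows "flip_at A B g \<in> gens n w"
proof -
  obtain v L where g: "g = (v, L)" by (cases g)
  have "L(A := a, B := b) \<in> circles n w v \<rightarrow>\<^sub>E UNIV" for a b
    using assms by (simp add: g gens_def PiE_iff extensional_def)
  then show ?thesis using assms(1) by (simp add: g flip_at_def gens_def)
qed

text \<open>In Lee's algebra (v_- a)(v_- b) = ab.\<close>

lemma merge_terms_flip: "(flip_label a, flip_label b, c) \<in> merge_terms \<longleftrightarrow> (a, b, c) \<in> merge_terms"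
  by (cases a; cases b; cases c) (auto simp: merge_terms_def)

text \<open>The coproduct is compatible with multiplication on either factor, so multiplying both
  factors of \<Delta>(a) by v_- gives \<Delta>(v_- v_- a) = \<Delta>(a).\<close>

lemma split_terms_flip: "(a, flip_label b, flip_label c) \<in> split_terms \<longleftrightarrow> (a, b, c) \<in> split_terms"
  by (cases a; cases b; cases c) (auto simp: split_terms_def)

text \<open>Two circles disappear, so the edge is a merge of exactly these two. One implication
  suffices: the converse follows by flipping once more.\<close>

lemma edge_term_flip_source_imp:
  assumes AB: "A \<noteq> B" "{A, B} \<subseteq> circles n w (fst g) - circles n w (fst g')" and e: "edge_term n w g g'"
  shows "edge_term n w (flip_at A B g) g'"
proof -
  obtain v L v' L' where g: "g = (v, L)" "g' = (v', L')" by (cases g, cases g')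
  let ?P = "circles n w v" and ?Q = "circles n w v'"
  let ?L = "L(A := flip_label (L A), B := flip_label (L B))"
  note e' = e[unfolded g edge_term_def prod.case]
  have sub: "A \<in> ?P - ?Q" "B \<in> ?P - ?Q" using AB(2) by (simp_all add: g)
  then have "L' C = ?L C" if "C \<in> ?P \<inter> ?Q" for C
    using conjunct1[OF e'] that by (metis Diff_iff Int_iff fun_upd_other)
  then have common: "\<forall>C \<in> ?P \<inter> ?Q. L' C = ?L C" by blast
  from conjunct2[OF e'] show ?thesis
  proof (elim disjE exE conjE)
    fix X Y C
    assume X: "X \<noteq> Y" "?P - ?Q = {X, Y}" "?Q - ?P = {C}" "(L X, L Y, L' C) \<in> merge_terms"
    have "(X = A \<and> Y = B) \<or> (X = B \<and> Y = A)" using sub AB(1) unfolding X(2) by blast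
    then have "?L X = flip_label (L X)" "?L Y = flip_label (L Y)" using AB(1) by auto
    then have "(?L X, ?L Y, L' C) \<in> merge_terms" using X(4) by (simp only: merge_terms_flip)
    then show ?thesis
      unfolding g flip_at_def edge_term_def prod.case
      by (intro conjI[OF common] disjI1 exI[of _ X] exI[of _ Y] exI[of _ C] conjI X(1-3))
  next
    fix X assume "?P - ?Q = {X}"
    then show ?thesis using sub AB(1) by simp
  qed
qed

text \<open>Dually, two circles appear, so the edge is a split into exactly these two.\<close>

lemma edge_term_flip_target_imp:
  assumes AB: "A \<noteq> B" "{A, B} \<subseteq> circles n w (fst g') - circles n w (fst g)" and e: "edge_term n w g g'"
  shows "edge_term n w g (flip_at A B g')"
proof -
  obtain v L v' L' where g: "g = (v, L)" "g' = (v', L')" by (cases g, cases g')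
  let ?P = "circles n w v" and ?Q = "circles n w v'"
  let ?L = "L'(A := flip_label (L' A), B := flip_label (L' B))"
  note e' = e[unfolded g edge_term_def prod.case]
  have sub: "A \<in> ?Q - ?P" "B \<in> ?Q - ?P" using AB(2) by (simp_all add: g)
  then have "?L C = L C" if "C \<in> ?P \<inter> ?Q" for C
    using conjunct1[OF e'] that by (metis Diff_iff Int_iff fun_upd_other)
  then have common: "\<forall>C \<in> ?P \<inter> ?Q. ?L C = L C" by blast
  from conjunct2[OF e'] show ?thesis
  proof (elim disjE exE conjE)
    fix X assume "?Q - ?P = {X}"
    then show ?thesis using sub AB(1) by simp
  next
    fix C X Y
    assume X: "X \<noteq> Y" "?P - ?Q = {C}" "?Q - ?P = {X, Y}" "(L C, L' X, L' Y) \<in> split_terms"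
    have "(X = A \<and> Y = B) \<or> (X = B \<and> Y = A)" using sub AB(1) unfolding X(3) by blast
    then have "?L X = flip_label (L' X)" "?L Y = flip_label (L' Y)" using AB(1) by auto
    then have "(L C, ?L X, ?L Y) \<in> split_terms" using X(4) by (simp only: split_terms_flip)
    then show ?thesis
      unfolding g flip_at_def edge_term_def prod.case
      by (intro conjI[OF common] disjI2 exI[of _ C] exI[of _ X] exI[of _ Y] conjI X(1-3))
  qed
qed

lemma lee_coeff_flip_source:
  assumes "A \<noteq> B" "{A, B} \<subseteq> circles n w (fst g) - circles n w (fst g')"
  shows "lee_coeff n w (flip_at A B g) g' = lee_coeff n w g g'"
proof -
  have "edge_term n w (flip_at A B g) g' \<longleftrightarrow> edge_term n w g g'"
  proof
    assume "edge_term n w (flip_at A B g) g'"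
    then have "edge_term n w (flip_at A B (flip_at A B g)) g'"
      by (rule edge_term_flip_source_imp[OF assms(1), rotated]) (use assms(2) in simp)
    then show "edge_term n w g g'" unfolding flip_at_flip_at[OF assms(1)] .
  qed (rule edge_term_flip_source_imp[OF assms])
  then show ?thesis by (simp add: lee_coeff_def)
qed

lemma lee_coeff_flip_target:
  assumes "A \<noteq> B" "{A, B} \<subseteq> circles n w (fst g') - circles n w (fst g)"
  shows "lee_coeff n w g (flip_at A B g') = lee_coeff n w g g'"
proof -
  have "edge_term n w g (flip_at A B g') \<longleftrightarrow> edge_term n w g g'"
  proof
    assume "edge_term n w g (flip_at A B g')"
    then have "edge_term n w g (flip_at A B (flip_at A B g'))"
      by (rule edge_term_flip_target_imp[OF assms(1), rotated]) (use assms(2) in simp)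
    then show "edge_term n w g g'" unfolding flip_at_flip_at[OF assms(1)] .
  qed (rule edge_term_flip_target_imp[OF assms])
  then show ?thesis by (simp add: lee_coeff_def)
qed

text \<open>The vectors v_- + v_+ and v_- - v_+ are eigenvectors of multiplication by v_- with
  eigenvalues 1 and -1, and adjacent strand circles carry one of each.\<close>

lemma canonical_label_coeff_flip:
  "canonical_label_coeff i (flip_label a) * canonical_label_coeff (i + 1) (flip_label b) =
    - (canonical_label_coeff i a * canonical_label_coeff (i + 1) b)"
  by (cases a; cases b) (auto simp: canonical_label_coeff_def)

lemma lee_canonical_flip:
  assumes i: "1 \<le> i" "i + 1 \<le> n" and g: "g \<in> gens n w"
  shows "lee_canonical n w (flip_at (strand_circle w i) (strand_circle w (i + 1)) g) =
    - lee_canonical n w g"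
proof (cases "fst g = oriented_vertex w")
  case True
  let ?A = "strand_circle w i" and ?B = "strand_circle w (i + 1)"
  obtain L where L: "g = (oriented_vertex w, L)" using True by (cases g) auto
  let ?L = "L(?A := flip_label (L ?A), ?B := flip_label (L ?B))"
  have split: "(\<Prod>p \<in> {1..n}. f p) = f i * f (i + 1) * (\<Prod>p \<in> {1..n} - {i, i + 1}. f p)"
    for f :: "nat \<Rightarrow> rat"
  proof -
    have "{1..n} = insert i (insert (i + 1) ({1..n} - {i, i + 1}))" using i by auto
    then have "(\<Prod>p \<in> {1..n}. f p) = prod f (insert i (insert (i + 1) ({1..n} - {i, i + 1})))"
      by simp
    also have "\<dots> = f i * f (i + 1) * prod f ({1..n} - {i, i + 1})"
      by (subst prod.insert; simp)+
    finally show ?thesis .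
  qed
  have rest: "(\<Prod>p \<in> {1..n} - {i, i + 1}. canonical_label_coeff p (?L (strand_circle w p))) =
      (\<Prod>p \<in> {1..n} - {i, i + 1}. canonical_label_coeff p (L (strand_circle w p)))"
    by (intro prod.cong) auto
  have "?A \<in> circles n w (oriented_vertex w)" "?B \<in> circles n w (oriented_vertex w)"
    using i by (auto simp: circles_oriented)
  then have "flip_at ?A ?B g \<in> gens n w" using flip_at_gens[OF g] True by simp
  then have "lee_canonical n w (flip_at ?A ?B g) = (\<Prod>p \<in> {1..n}. canonical_label_coeff p (?L (strand_circle w p)))"
    by (simp add: L flip_at_def lee_canonical_def del: fun_upd_apply)
  also have "\<dots> = canonical_label_coeff i (flip_label (L ?A)) * canonical_label_coeff (i + 1) (flip_label (L ?B)) *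
      (\<Prod>p \<in> {1..n} - {i, i + 1}. canonical_label_coeff p (L (strand_circle w p)))"
    unfolding split rest by simp
  also have "\<dots> = - (\<Prod>p \<in> {1..n}. canonical_label_coeff p (L (strand_circle w p)))"
    unfolding split canonical_label_coeff_flip by simp
  also have "\<dots> = - lee_canonical n w g"
    using g by (simp add: L lee_canonical_def)
  finally show ?thesis .
next
  case False
  then show ?thesis by (auto simp: lee_canonical_def flip_at_def split: prod.splits)
qed

text \<open>Reindexing by the involution shows that the sum equals its own negative, so fixed points
  need no separate treatment.\<close>

lemma sum_involution_zero:
  fixes f :: "'a \<Rightarrow> rat"
  assumes "\<And>g. g \<in> G \<Longrightarrow> h g \<in> G" "\<And>g. g \<in> G \<Longrightarrow> h (h g) = g" "\<And>g. g \<in> G \<Longrightarrow> f (h g) = - f g"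
  shows "sum f G = 0"
proof -
  have "sum f G = (\<Sum>g \<in> G. - f g)"
    by (rule sum.reindex_bij_witness[of _ h h]) (use assms in auto)
  then show ?thesis by (simp add: sum_negf)
qed

lemma lee_canonical_nonzero:
  "lee_canonical n w g \<noteq> 0 \<Longrightarrow> g \<in> gens n w \<and> fst g = oriented_vertex w"
  by (auto simp: lee_canonical_def split: prod.splits if_splits)

lemma sum_gens_oriented:
  fixes f :: "gen \<Rightarrow> rat"
  shows "(\<Sum>g \<in> gens n w. f g * lee_canonical n w g) =
    (\<Sum>g \<in> {g \<in> gens n w. fst g = oriented_vertex w}. f g * lee_canonical n w g)"
  using lee_canonical_nonzero[of n w] by (intro sum.mono_neutral_right) (auto simp: finite_gens)

text \<open>An edge at the oriented vertex merges or splits two adjacent strand circles. Its matrix entries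
  do not change when both labels are flipped, whereas the coefficients of the canonical cycle
  change sign.\<close>

lemma lee_canonical_cycle_sum:
  assumes w: "w \<in> braid_words n"
  shows "(\<Sum>g \<in> gens n w. lee_coeff n w g g' * lee_canonical n w g) = 0"
proof (cases "\<exists>c < length w. c \<notin> oriented_vertex w \<and> fst g' = insert c (oriented_vertex w)")
  case False
  then have "lee_coeff n w g g' = 0 \<or> lee_canonical n w g = 0" for g
    using lee_coeff_nonzero[of n w g g'] lee_canonical_nonzero[of n w g] by metis
  then show ?thesis by (intro sum.neutral) auto
next
  case True
  then obtain c where c: "c < length w" "c \<notin> oriented_vertex w" "fst g' = insert c (oriented_vertex w)"
    by auto
  \<comment> \<open>Crossing \<open>c\<close> is positive since it lies outside
    \<open>oriented_vertex w\<close>, so its 1-resolution is the unoriented one.\<close>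
  then have "\<not> oriented_at w (fst g') c" by (auto simp: oriented_at_def oriented_vertex_def)
  note S = unoriented_strand_not_circle[OF c(1) this, of n]
  note i = braid_word_nth[OF w c(1)]
  let ?A = "strand_circle w (fst (w ! c))" and ?B = "strand_circle w (fst (w ! c) + 1)"
  have circ: "{?A, ?B} \<subseteq> circles n w (oriented_vertex w) - circles n w (fst g')"
    using S i by (auto simp: circles_oriented)
  have "(\<Sum>g \<in> {g \<in> gens n w. fst g = oriented_vertex w}. lee_coeff n w g g' * lee_canonical n w g) = 0"
  proof (rule sum_involution_zero[of _ "flip_at ?A ?B"])
    fix g assume "g \<in> {g \<in> gens n w. fst g = oriented_vertex w}"
    then have g: "g \<in> gens n w" "fst g = oriented_vertex w" by auto
    show "flip_at ?A ?B g \<in> {g \<in> gens n w. fst g = oriented_vertex w}"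
      using flip_at_gens[OF g(1)] g(2) circ by auto
    show "flip_at ?A ?B (flip_at ?A ?B g) = g" by (simp add: flip_at_flip_at)
    have "lee_coeff n w (flip_at ?A ?B g) g' = lee_coeff n w g g'"
      by (rule lee_coeff_flip_source) (use circ g(2) in auto)
    then show "lee_coeff n w (flip_at ?A ?B g) g' * lee_canonical n w (flip_at ?A ?B g) =
        - (lee_coeff n w g g' * lee_canonical n w g)"
      by (simp add: lee_canonical_flip[OF i g(1), simplified])
  qed
  then show ?thesis by (simp add: sum_gens_oriented)
qed

text \<open>The transposed cancellation: the edges now end at the oriented vertex, the changed
  crossing is negative, and the two strand circles arise from a split.\<close>

lemma lee_canonical_cocycle_sum:
  assumes w: "w \<in> braid_words n"
  shows "(\<Sum>g' \<in> gens n w. lee_coeff n w g g' * lee_canonical n w g') = 0"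
proof (cases "\<exists>c < length w. c \<notin> fst g \<and> oriented_vertex w = insert c (fst g)")
  case False
  then have "lee_coeff n w g g' = 0 \<or> lee_canonical n w g' = 0" for g'
    using lee_coeff_nonzero[of n w g g'] lee_canonical_nonzero[of n w g'] by metis
  then show ?thesis by (intro sum.neutral) auto
next
  case True
  then obtain c where c: "c < length w" "c \<notin> fst g" "oriented_vertex w = insert c (fst g)"
    by auto
  then have "\<not> oriented_at w (fst g) c" by (auto simp: oriented_at_def oriented_vertex_def)
  note S = unoriented_strand_not_circle[OF c(1) this, of n]
  note i = braid_word_nth[OF w c(1)]
  let ?A = "strand_circle w (fst (w ! c))" and ?B = "strand_circle w (fst (w ! c) + 1)"
  have circ: "{?A, ?B} \<subseteq> circles n w (oriented_vertex w) - circles n w (fst g)"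
    using S i by (auto simp: circles_oriented)
  have "(\<Sum>g' \<in> {g' \<in> gens n w. fst g' = oriented_vertex w}. lee_coeff n w g g' * lee_canonical n w g') = 0"
  proof (rule sum_involution_zero[of _ "flip_at ?A ?B"])
    fix g' assume "g' \<in> {g' \<in> gens n w. fst g' = oriented_vertex w}"
    then have g': "g' \<in> gens n w" "fst g' = oriented_vertex w" by auto
    show "flip_at ?A ?B g' \<in> {g' \<in> gens n w. fst g' = oriented_vertex w}"
      using flip_at_gens[OF g'(1)] g'(2) circ by auto
    show "flip_at ?A ?B (flip_at ?A ?B g') = g'" by (simp add: flip_at_flip_at)
    have "lee_coeff n w g (flip_at ?A ?B g') = lee_coeff n w g g'"
      by (rule lee_coeff_flip_target) (use circ g'(2) in auto)
    then show "lee_coeff n w g (flip_at ?A ?B g') * lee_canonical n w (flip_at ?A ?B g') =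
        - (lee_coeff n w g g' * lee_canonical n w g')"
      by (simp add: lee_canonical_flip[OF i g'(1), simplified])
  qed
  then show ?thesis by (simp add: sum_gens_oriented)
qed

lemma lee_canonical_cycle:
  assumes "w \<in> braid_words n"
  shows "lee_canonical n w \<in> lee_cycles n w"
  using lee_canonical_cycle_sum[OF assms] lee_canonical_nonzero[of n w]
  by (auto simp: lee_cycles_def chains_def lee_diff_def)

text \<open>After exchanging the sums, this is the cocycle property. Hence the coefficientwise
  pairing with the canonical chain is constant on homology classes.\<close>

lemma lee_canonical_pairing_boundary:
  assumes "w \<in> braid_words n"
  shows "(\<Sum>g \<in> gens n w. lee_diff n w z g * lee_canonical n w g) = 0"
proof -
  have "(\<Sum>g' \<in> gens n w. lee_diff n w z g' * lee_canonical n w g') =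
      (\<Sum>g' \<in> gens n w. \<Sum>g \<in> gens n w. z g * (lee_coeff n w g g' * lee_canonical n w g'))"
  proof (rule sum.cong[OF HOL.refl])
    fix g' assume "g' \<in> gens n w"
    then show "lee_diff n w z g' * lee_canonical n w g' =
        (\<Sum>g \<in> gens n w. z g * (lee_coeff n w g g' * lee_canonical n w g'))"
      unfolding lee_diff_def by (simp only: if_True sum_distrib_right) (simp only: mult_ac)
  qed
  also have "\<dots> = (\<Sum>g \<in> gens n w. z g * (\<Sum>g' \<in> gens n w. lee_coeff n w g g' * lee_canonical n w g'))"
    by (subst sum.swap) (simp add: sum_distrib_left)
  also have "\<dots> = 0" by (simp add: lee_canonical_cocycle_sum[OF assms])
  finally show ?thesis .
qed

text \<open>The part of the canonical cycle in \<open>R\<close> pairs positively with the canonical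
  chain because of \<open>g\<close>. The same part of \<open>x\<close> has the same pairing, so it
  has a nonzero coefficient somewhere on the support of the canonical chain.\<close>

lemma homologous_quantum_part_support:
  assumes w: "w \<in> braid_words n" and x: "homologous n w x (lee_canonical n w)"
    and g: "lee_canonical n w g \<noteq> 0" "quantum_grading n w g mod 4 \<in> R"
  shows "\<exists>h \<in> gens n w. fst h = oriented_vertex w \<and> quantum_grading n w h mod 4 \<in> R \<and> x h \<noteq> 0"
proof -
  let ?y = "quantum_part n w R x" and ?s = "quantum_part n w R (lee_canonical n w)"
  obtain z where "(\<lambda>g. ?y g - ?s g) = lee_diff n w z"
    using homologous_quantum_part[OF x] unfolding homologous_def by blast
  then have "?y g = lee_diff n w z g + ?s g" for g by (metis diff_add_cancel)
  then have "(\<Sum>g \<in> gens n w. ?y g * lee_canonical n w g) = (\<Sum>g \<in> gens n w. ?s g * lee_canonical n w g)"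
    using lee_canonical_pairing_boundary[OF w, of z] by (simp add: distrib_right sum.distrib)
  \<comment> \<open>Every term is a square or 0, and the term at \<open>g\<close> is
    positive.\<close>
  moreover have "(\<Sum>g \<in> gens n w. ?s g * lee_canonical n w g) > 0"
    using g lee_canonical_nonzero[OF g(1)]
    by (intro sum_pos2[of _ g]) (auto simp: finite_gens quantum_part_def zero_less_mult_iff linorder_neq_iff)
  ultimately have "(\<Sum>g \<in> gens n w. ?y g * lee_canonical n w g) \<noteq> 0" by simp
  then obtain h where "h \<in> gens n w" "?y h * lee_canonical n w h \<noteq> 0"
    using sum.not_neutral_contains_not_neutral by blast
  then show ?thesis
    using lee_canonical_nonzero[of n w h] by (auto simp: quantum_part_def split: if_splits)
qed

lemma lee_canonical_oriented:
  assumes "(oriented_vertex w, L) \<in> gens n w"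
  shows "lee_canonical n w (oriented_vertex w, L) \<noteq> 0"
proof -
  have "canonical_label_coeff p a \<noteq> 0" for p a
    by (cases a) (simp_all add: canonical_label_coeff_def)
  then show ?thesis using assms by (simp add: lee_canonical_def)
qed

text \<open>An explicit witness that the canonical cycle has a term, and on three strands one in the
  residue class of \<open>writhe w - 3\<close>.\<close>

lemma minus_labels_gens:
  "(oriented_vertex w, \<lambda>C \<in> circles n w (oriented_vertex w). Minus) \<in> gens n w"
  by (simp add: gens_def oriented_vertex_vertices)

section \<open>The annular Rasmussen invariant\<close>

definition represents_canonical :: "nat \<Rightarrow> braid_word \<Rightarrow> chain \<Rightarrow> bool" where
  "represents_canonical n w x \<longleftrightarrow> x \<in> lee_cycles n w \<and> homologous n w x (lee_canonical n w)"

lemma represents_lee_canonical: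
  assumes "w \<in> braid_words n"
  shows "represents_canonical n w (lee_canonical n w)"
proof -
  have "(\<lambda>g. lee_canonical n w g - lee_canonical n w g) = lee_diff n w (\<lambda>_. 0)"
    by (auto simp: lee_diff_def)
  then have "homologous n w (lee_canonical n w) (lee_canonical n w)"
    unfolding homologous_def by (intro bexI[of _ "\<lambda>_. 0"]) (auto simp: chains_def)
  then show ?thesis using lee_canonical_cycle[OF assms] by (simp add: represents_canonical_def)
qed

text \<open>Replaces the maximum of minima by the existence of one representative; from here on the
  invariant is handled through this equivalence.\<close>

lemma annular_rasmussen_ge_iff:
  assumes w: "w \<in> braid_words n"
  shows "r \<le> annular_rasmussen n w t \<longleftrightarrow>
    (\<exists>x. represents_canonical n w x \<and> (\<forall>g \<in> gens n w. x g \<noteq> 0 \<longrightarrow> r \<le> j_gen n w t g))"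
proof -
  let ?J = "\<lambda>x. {j_gen n w t g | g. g \<in> gens n w \<and> x g \<noteq> 0}"
  let ?X = "Collect (represents_canonical n w)"
  have fin: "finite (?J x)" for x
    by (rule finite_subset[of _ "j_gen n w t ` gens n w"]) (auto simp: finite_gens)
  \<comment> \<open>With all residues allowed, the pairing argument gives a representative a nonzero
    coefficient, so its minimum is over a nonempty set and it is not the zero chain.\<close>
  have supp: "\<exists>g \<in> gens n w. x g \<noteq> 0" if "x \<in> ?X" for x
    using homologous_quantum_part_support[OF w _ lee_canonical_oriented[OF minus_labels_gens], of x UNIV] that
    by (auto simp: represents_canonical_def)
  have nonempty: "?J x \<noteq> {}" if "x \<in> ?X" for x using supp[OF that] by blast
  have nonzero: "x \<noteq> (\<lambda>_. 0)" if "x \<in> ?X" for x using supp[OF that] by auto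
  have set_eq: "{j_chain n w t x | x. x \<in> lee_cycles n w \<and> x \<noteq> (\<lambda>_. 0) \<and> homologous n w x (lee_canonical n w)}
      = j_chain n w t ` ?X"
    using nonzero unfolding represents_canonical_def by blast
  \<comment> \<open>There may be infinitely many representatives, but each minimum is the grading of
    one of finitely many generators, so the maximum exists.\<close>
  have "j_chain n w t x \<in> j_gen n w t ` gens n w" if "x \<in> ?X" for x
    using Min_in[OF fin nonempty[OF that]] unfolding j_chain_def by auto
  then have "j_chain n w t ` ?X \<subseteq> j_gen n w t ` gens n w" by auto
  then have finX: "finite (j_chain n w t ` ?X)"
    by (rule finite_subset) (simp add: finite_gens)
  have neX: "?X \<noteq> {}" using represents_lee_canonical[OF w] by auto
  have chain_ge: "r \<le> j_chain n w t x \<longleftrightarrow> (\<forall>g \<in> gens n w. x g \<noteq> 0 \<longrightarrow> r \<le> j_gen n w t g)"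
    if "x \<in> ?X" for x
    unfolding j_chain_def Min_ge_iff[OF fin nonempty[OF that]] by blast
  have "r \<le> annular_rasmussen n w t \<longleftrightarrow> (\<exists>x \<in> ?X. r \<le> j_chain n w t x)"
    unfolding annular_rasmussen_def set_eq using Max_ge_iff[OF finX] neX by simp
  then show ?thesis using chain_ge by auto
qed

lemma annular_rasmussen_geI:
  assumes "w \<in> braid_words n" "represents_canonical n w x"
    "\<And>g. g \<in> gens n w \<Longrightarrow> x g \<noteq> 0 \<Longrightarrow> r \<le> j_gen n w t g"
  shows "r \<le> annular_rasmussen n w t"
  using assms by (auto simp: annular_rasmussen_ge_iff)

lemma annular_rasmussen_attained:
  assumes "w \<in> braid_words n"
  obtains x where "represents_canonical n w x"
    "\<And>g. g \<in> gens n w \<Longrightarrow> x g \<noteq> 0 \<Longrightarrow> annular_rasmussen n w t \<le> j_gen n w t g"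
  using annular_rasmussen_ge_iff[OF assms, of "annular_rasmussen n w t" t] that by blast

section \<open>Closures of 3-braids\<close>

text \<open>At the oriented vertex j_t is affine in k with slope \<open>1 - t\<close>, so comparing
  gradings there reduces to comparing k; elsewhere the bound on k keeps j_t within \<open>t\<close>
  of j when \<open>t\<close> is nonnegative.\<close>

lemma gen_cases:
  assumes "w \<in> braid_words 3" "g \<in> gens 3 w"
  obtains (oriented) k where "fst g = oriented_vertex w" "k \<in> {-3, -1, 1, 3}"
      "quantum_grading 3 w g = writhe w + k" "annular_grading 3 w g = k"
      "\<And>t :: real. j_gen 3 w t g = writhe w + (1 - t) * k"
    | (unoriented) "fst g \<noteq> oriented_vertex w" "\<bar>annular_grading 3 w g\<bar> \<le> 1"
proof -
  obtain v L where g: "g = (v, L)" by (cases g)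
  show thesis
  proof (cases "v = oriented_vertex w")
    case True
    then have q: "quantum_grading 3 w g = writhe w + annular_grading 3 w g"
      using g quantum_grading_oriented by simp
    have j: "j_gen 3 w t g = writhe w + (1 - t) * annular_grading 3 w g" for t :: real
      unfolding j_gen_def q by (simp add: left_diff_distrib)
    have "annular_grading 3 w g \<in> {-3, -1, 1, 3}"
      using True g annular_grading_oriented_3 by simp
    then show thesis using oriented[OF _ _ q HOL.refl j] True g by simp
  next
    case False
    then show thesis
      using unoriented annular_grading_unoriented[OF assms(1) assms(2)[unfolded g] False] g by simp
  qed
qed

lemma odd_shift_mod_4:
  fixes m k :: int
  assumes "k \<in> {-3, -1, 1, 3}"
  shows "(m + k) mod 4 = (m + 1) mod 4 \<longleftrightarrow> k = 1 \<or> k = -3"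
    "(m + k) mod 4 = (m - 1) mod 4 \<longleftrightarrow> k = -1 \<or> k = 3"
proof -
  have "(m + k) mod 4 = (m + 1) mod 4 \<longleftrightarrow> 4 dvd k - 1" "(m + k) mod 4 = (m - 1) mod 4 \<longleftrightarrow> 4 dvd k + 1"
    by (simp_all add: mod_eq_dvd_iff)
  then show "(m + k) mod 4 = (m + 1) mod 4 \<longleftrightarrow> k = 1 \<or> k = -3"
    "(m + k) mod 4 = (m - 1) mod 4 \<longleftrightarrow> k = -1 \<or> k = 3"
    using assms by auto
qed

lemma lee_canonical_parts:
  assumes "w \<in> braid_words 3"
  shows "quantum_part 3 w {(writhe w + 1) mod 4, (writhe w - 1) mod 4} (lee_canonical 3 w) g = lee_canonical 3 w g"
    and "quantum_part 3 w {(writhe w + 1) mod 4} (lee_canonical 3 w) g +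
      quantum_part 3 w {(writhe w - 1) mod 4} (lee_canonical 3 w) g = lee_canonical 3 w g"
proof -
  \<comment> \<open>Inequality of truth values expresses exclusive or: one residue for the first
    claim, not both for the second.\<close>
  have *: "(quantum_grading 3 w g mod 4 = (writhe w + 1) mod 4) \<noteq>
      (quantum_grading 3 w g mod 4 = (writhe w - 1) mod 4)" if nz: "lee_canonical 3 w g \<noteq> 0"
  proof -
    have g: "g \<in> gens 3 w" "fst g = oriented_vertex w" using lee_canonical_nonzero[OF nz] by auto
    from assms g(1) show ?thesis
    proof (cases rule: gen_cases)
      case (oriented k)
      then show ?thesis using odd_shift_mod_4[of k "writhe w"] by auto
    next
      case unoriented
      then show ?thesis using g(2) by simp
    qed
  qed
  show "quantum_part 3 w {(writhe w + 1) mod 4, (writhe w - 1) mod 4} (lee_canonical 3 w) g = lee_canonical 3 w g"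
    "quantum_part 3 w {(writhe w + 1) mod 4} (lee_canonical 3 w) g +
      quantum_part 3 w {(writhe w - 1) mod 4} (lee_canonical 3 w) g = lee_canonical 3 w g"
    using * by (cases "lee_canonical 3 w g = 0"; simp add: quantum_part_def; blast)+
qed

text \<open>The canonical cycle lies in gradings of the parity of \<open>writhe w + 1\<close>, so
  projecting \<open>x\<close> to that parity keeps its class. On the projection the value
  \<open>r - 1\<close> is excluded, which improves the strict bound \<open>r - 2\<close> to
  \<open>r\<close>.\<close>

lemma represents_parity_gap:
  assumes w: "w \<in> braid_words 3" and x: "represents_canonical 3 w x"
    and r: "even (r - writhe w - 1)" "\<And>g. g \<in> gens 3 w \<Longrightarrow> x g \<noteq> 0 \<Longrightarrow> r - 2 < quantum_grading 3 w g"
  shows "\<exists>y. represents_canonical 3 w y \<and> (\<forall>g \<in> gens 3 w. y g \<noteq> 0 \<longrightarrow> r \<le> quantum_grading 3 w g)"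
proof (intro exI conjI ballI impI)
  let ?R = "{(writhe w + 1) mod 4, (writhe w - 1) mod 4}"
  have "quantum_part 3 w ?R (lee_canonical 3 w) = lee_canonical 3 w"
    by (rule ext) (rule lee_canonical_parts(1)[OF w])
  then show "represents_canonical 3 w (quantum_part 3 w ?R x)"
    using x homologous_quantum_part[of 3 w x "lee_canonical 3 w" ?R]
    by (simp add: represents_canonical_def quantum_part_cycle)
  fix g assume g: "g \<in> gens 3 w" "quantum_part 3 w ?R x g \<noteq> 0"
  then have "r - 2 < quantum_grading 3 w g" using r(2) by (auto simp: quantum_part_def split: if_splits)
  moreover have "even (r - quantum_grading 3 w g)"
  proof -
    have "quantum_grading 3 w g mod 4 = (writhe w + 1) mod 4 \<or> quantum_grading 3 w g mod 4 = (writhe w - 1) mod 4"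
      using g(2) by (simp add: quantum_part_def split: if_splits)
    then have "4 dvd quantum_grading 3 w g - (writhe w + 1) \<or> 4 dvd quantum_grading 3 w g - (writhe w - 1)"
      by (simp only: mod_eq_dvd_iff)
    moreover have "even i" if "4 dvd i" for i :: int
      by (rule dvd_trans[OF _ that]) simp
    ultimately have "even (quantum_grading 3 w g - (writhe w + 1)) \<or> even (quantum_grading 3 w g - (writhe w - 1))"
      by blast
    then show ?thesis using r(1) by simp
  qed
  ultimately show "r \<le> quantum_grading 3 w g" by (cases "r = quantum_grading 3 w g + 1") simp_all
qed

section \<open>Bounds on the invariant and comparison of j_t with j\<close>

lemma annular_rasmussen_le:
  fixes t :: real
  assumes w: "w \<in> braid_words 3" and t: "t \<le> 1"
  shows "annular_rasmussen 3 w t \<le> writhe w + 1 - t"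
proof -
  obtain x where x: "represents_canonical 3 w x"
    "\<And>g. g \<in> gens 3 w \<Longrightarrow> x g \<noteq> 0 \<Longrightarrow> annular_rasmussen 3 w t \<le> j_gen 3 w t g"
    using annular_rasmussen_attained[OF w] by blast
  \<comment> \<open>The all-minus generator has k = -3, which lies in the class of
    \<open>writhe w + 1\<close> modulo 4.\<close>
  let ?m = "(oriented_vertex w, \<lambda>C \<in> circles 3 w (oriented_vertex w). Minus)"
  have "quantum_grading 3 w ?m = writhe w - 3"
    by (simp add: quantum_grading_oriented annular_grading_oriented circles_oriented label_val_def)
  then have m: "quantum_grading 3 w ?m mod 4 \<in> {(writhe w + 1) mod 4}" using odd_shift_mod_4(1)[of "-3" "writhe w"] by simp
  have "homologous 3 w x (lee_canonical 3 w)" using x(1) by (simp add: represents_canonical_def)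
  from homologous_quantum_part_support[OF w this lee_canonical_oriented[OF minus_labels_gens] m]
  obtain h where h: "h \<in> gens 3 w" "fst h = oriented_vertex w" "x h \<noteq> 0"
    "quantum_grading 3 w h mod 4 = (writhe w + 1) mod 4" by auto
  from w h(1) show ?thesis
  proof (cases rule: gen_cases)
    case (oriented k)
    have "k = 1 \<or> k = -3" using odd_shift_mod_4(1)[OF oriented(2)] oriented(3) h(4) by simp
    then have "(1 - t) * k \<le> 1 - t" using t by auto
    then show ?thesis using x(2)[OF h(1,3)] oriented(5)[of t] by simp
  next
    case unoriented
    then show ?thesis using h(2) by simp
  qed
qed

text \<open>The canonical cycle lives at the oriented vertex, where \<open>(1 - t) * k\<close> is
  smallest at k = -3.\<close>

lemma annular_rasmussen_ge:
  fixes t :: real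
  assumes w: "w \<in> braid_words 3" and t: "t \<le> 1"
  shows "writhe w - 3 + 3 * t \<le> annular_rasmussen 3 w t"
proof (rule annular_rasmussen_geI[OF w represents_lee_canonical[OF w]])
  fix g assume g: "g \<in> gens 3 w" "lee_canonical 3 w g \<noteq> 0"
  from w g(1) show "writhe w - 3 + 3 * t \<le> j_gen 3 w t g"
  proof (cases rule: gen_cases)
    case (oriented k)
    have "(1 - t) * (-3) \<le> (1 - t) * k" using oriented(2) t by (intro mult_left_mono) auto
    then show ?thesis using oriented(5)[of t] by simp
  next
    case unoriented
    then show ?thesis using lee_canonical_nonzero[OF g(2)] by simp
  qed
qed

text \<open>At the oriented vertex the hypothesis forces k to be at least 1; elsewhere k is at most
  1, so at most \<open>t\<close> is subtracted.\<close>

lemma j_gen_ge_top: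
  fixes t :: real
  assumes w: "w \<in> braid_words 3" and g: "g \<in> gens 3 w" "writhe w + 1 \<le> quantum_grading 3 w g"
    and t: "t \<in> {0..1}"
  shows "writhe w + 1 - t \<le> j_gen 3 w t g"
  using w g(1)
proof (cases rule: gen_cases)
  case (oriented k)
  have "(1 - t) * 1 \<le> (1 - t) * k" using oriented(3) g(2) t by (intro mult_left_mono) auto
  then show ?thesis using oriented(5)[of t] by simp
next
  case unoriented
  have "t * annular_grading 3 w g \<le> t * 1" using unoriented t by (intro mult_left_mono) auto
  moreover have "real_of_int (writhe w + 1) \<le> quantum_grading 3 w g" using g(2) by linarith
  ultimately show ?thesis by (simp add: j_gen_def)
qed

text \<open>Recovers a bound on j from a bound on j_t at a single \<open>t\<close>. At the oriented
  vertex one cancels \<open>1 - t\<close>, which is positive; elsewhere k is at least -1 and hence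
  at least \<open>m\<close>, so the term \<open>t * k\<close> only helps.\<close>

lemma quantum_grading_gt:
  fixes t :: real
  assumes w: "w \<in> braid_words 3" and t: "t \<in> {0..<1}" and m: "m \<le> -1"
    and g: "g \<in> gens 3 w" "writhe w + (1 - t) * m < j_gen 3 w t g"
  shows "writhe w + m < quantum_grading 3 w g"
  using w g(1)
proof (cases rule: gen_cases)
  case (oriented k)
  have "(1 - t) * real_of_int m < (1 - t) * real_of_int k" using g(2) oriented(5)[of t] by simp
  moreover have "0 < 1 - t" using t by simp
  ultimately have "m < k" by (simp only: mult_less_cancel_left_pos of_int_less_iff)
  then show ?thesis using oriented(3) by simp
next
  case unoriented
  have "t * real_of_int m \<le> t * real_of_int (annular_grading 3 w g)"
    using unoriented t m by (intro mult_left_mono) auto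
  then have "real_of_int (writhe w + m) < real_of_int (quantum_grading 3 w g)"
    using g(2) by (simp add: j_gen_def left_diff_distrib)
  then show ?thesis by (simp only: of_int_less_iff)
qed

section \<open>The three possible forms of the invariant\<close>

lemma annular_rasmussen_top:
  fixes t :: real
  assumes w: "w \<in> braid_words 3" and t: "t \<in> {0..1}" and x: "represents_canonical 3 w x"
    "\<forall>g \<in> gens 3 w. x g \<noteq> 0 \<longrightarrow> writhe w + 1 \<le> quantum_grading 3 w g"
  shows "annular_rasmussen 3 w t = writhe w + 1 - t"
proof (rule antisym)
  show "annular_rasmussen 3 w t \<le> writhe w + 1 - t" using annular_rasmussen_le[OF w] t by simp
  show "writhe w + 1 - t \<le> annular_rasmussen 3 w t"
    by (rule annular_rasmussen_geI[OF w x(1)]) (use j_gen_ge_top[OF w _ _ t] x(2) in auto)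
qed

lemma annular_rasmussen_middle_ge:
  fixes t :: real
  assumes w: "w \<in> braid_words 3" and t: "t \<in> {0..1}" and x: "represents_canonical 3 w x"
    "\<forall>g \<in> gens 3 w. x g \<noteq> 0 \<longrightarrow> writhe w - 1 \<le> quantum_grading 3 w g"
  shows "writhe w - 1 + t \<le> annular_rasmussen 3 w t"
proof (rule annular_rasmussen_geI[OF w])
  let ?a = "quantum_part 3 w {(writhe w + 1) mod 4}" and ?b = "quantum_part 3 w {(writhe w - 1) mod 4}"
  \<comment> \<open>In the class of \<open>writhe w + 1\<close> modulo 4 the bound on \<open>x\<close> improves by 2; in the other class the
    canonical cycle is already good enough.\<close>
  let ?y = "\<lambda>g. ?a x g + ?b (lee_canonical 3 w) g"
  have "homologous 3 w (?a x) (?a (lee_canonical 3 w))"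
    using x(1) by (simp add: represents_canonical_def homologous_quantum_part)
  from homologous_add[OF this, of "?b (lee_canonical 3 w)"]
  have "homologous 3 w ?y (lee_canonical 3 w)" by (simp add: lee_canonical_parts(2)[OF w])
  moreover have "?y \<in> lee_cycles 3 w"
    using x(1) lee_canonical_cycle[OF w]
    by (intro lee_cycles_add quantum_part_cycle) (auto simp: represents_canonical_def)
  ultimately show "represents_canonical 3 w ?y" by (simp add: represents_canonical_def)
  fix g assume g: "g \<in> gens 3 w" "?y g \<noteq> 0"
  then have "?a x g \<noteq> 0 \<or> ?b (lee_canonical 3 w) g \<noteq> 0" by auto
  then consider "quantum_grading 3 w g mod 4 = (writhe w + 1) mod 4" "x g \<noteq> 0"
    | "quantum_grading 3 w g mod 4 = (writhe w - 1) mod 4" "lee_canonical 3 w g \<noteq> 0"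
    unfolding quantum_part_def singleton_iff by metis
  then show "writhe w - 1 + t \<le> j_gen 3 w t g"
  proof cases
    case 1
    then have "writhe w - 1 \<le> quantum_grading 3 w g" using x(2) g(1) by simp
    moreover have "4 dvd quantum_grading 3 w g - (writhe w + 1)" using 1(1) by (simp only: mod_eq_dvd_iff)
    then obtain k where "quantum_grading 3 w g - (writhe w + 1) = 4 * k" by (elim dvdE)
    \<comment> \<open>The next value below \<open>writhe w + 1\<close> in its class modulo 4 is
      \<open>writhe w - 3\<close>, which the bound on \<open>x\<close> excludes.\<close>
    ultimately have "writhe w + 1 \<le> quantum_grading 3 w g" by presburger
    then show ?thesis using j_gen_ge_top[OF w g(1) _ t] t by simp
  next
    case 2
    from w g(1) show ?thesis
    proof (cases rule: gen_cases)
      case (oriented k)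
      have "k = -1 \<or> k = 3" using odd_shift_mod_4(2)[OF oriented(2)] oriented(3) 2(1) by simp
      then have "(1 - t) * (-1) \<le> (1 - t) * k" using t by (intro mult_left_mono) auto
      then show ?thesis using oriented(5)[of t] by simp
    next
      case unoriented
      then show ?thesis using lee_canonical_nonzero[OF 2(2)] by simp
    qed
  qed
qed

text \<open>For \<open>t < 1\<close> a larger value would give a representative with j at least
  \<open>writhe w + 1\<close>, by the comparison of gradings and the parity gap. At
  \<open>t = 1\<close> the claim coincides with the general upper bound.\<close>

lemma annular_rasmussen_middle_le:
  fixes t :: real
  assumes w: "w \<in> braid_words 3" and t: "t \<in> {0..1}"
    and x: "\<nexists>x. represents_canonical 3 w x \<and> (\<forall>g \<in> gens 3 w. x g \<noteq> 0 \<longrightarrow> writhe w + 1 \<le> quantum_grading 3 w g)"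
  shows "annular_rasmussen 3 w t \<le> writhe w - 1 + t"
proof (cases "t = 1")
  case True
  then show ?thesis using annular_rasmussen_le[OF w, of 1] by simp
next
  case False
  show ?thesis
  proof (rule ccontr)
    assume gt: "\<not> ?thesis"
    obtain y where y: "represents_canonical 3 w y"
      "\<And>g. g \<in> gens 3 w \<Longrightarrow> y g \<noteq> 0 \<Longrightarrow> annular_rasmussen 3 w t \<le> j_gen 3 w t g"
      using annular_rasmussen_attained[OF w] by blast
    have "writhe w + 1 - 2 < quantum_grading 3 w g" if "g \<in> gens 3 w" "y g \<noteq> 0" for g
      using quantum_grading_gt[OF w _ _ that(1), of t "-1"] y(2)[OF that] gt t False by simp
    from represents_parity_gap[OF w y(1) _ this] show False using x by simp
  qed
qed

text \<open>The same argument one step lower; at \<open>t = 1\<close> the general lower and upper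
  bounds both equal \<open>writhe w\<close>.\<close>

lemma annular_rasmussen_bottom:
  fixes t :: real
  assumes w: "w \<in> braid_words 3" and t: "t \<in> {0..1}"
    and x: "\<nexists>x. represents_canonical 3 w x \<and> (\<forall>g \<in> gens 3 w. x g \<noteq> 0 \<longrightarrow> writhe w - 1 \<le> quantum_grading 3 w g)"
  shows "annular_rasmussen 3 w t = writhe w - 3 + 3 * t"
proof (cases "t = 1")
  case True
  then show ?thesis using annular_rasmussen_le[OF w, of 1] annular_rasmussen_ge[OF w, of 1] by simp
next
  case False
  have "\<not> writhe w - 3 + 3 * t < annular_rasmussen 3 w t"
  proof
    assume gt: "writhe w - 3 + 3 * t < annular_rasmussen 3 w t"
    obtain y where y: "represents_canonical 3 w y"
      "\<And>g. g \<in> gens 3 w \<Longrightarrow> y g \<noteq> 0 \<Longrightarrow> annular_rasmussen 3 w t \<le> j_gen 3 w t g"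
      using annular_rasmussen_attained[OF w] by blast
    have "writhe w - 1 - 2 < quantum_grading 3 w g" if "g \<in> gens 3 w" "y g \<noteq> 0" for g
      using quantum_grading_gt[OF w _ _ that(1), of t "-3"] y(2)[OF that] gt t False by simp
    from represents_parity_gap[OF w y(1) _ this] show False using x by simp
  qed
  then show ?thesis using annular_rasmussen_ge[OF w, of t] t by simp
qed

theorem theorem3p7:
  fixes \<beta> :: "braid_word set" and w :: braid_word
  assumes "\<beta> \<in> carrier (braid_group 3)" and "w \<in> \<beta>"
  shows "(rasmussen_s 3 w = of_int (writhe w) - 2 \<and>
            (\<forall>t \<in> {0..1}. annular_rasmussen 3 w t = of_int (writhe w) - 3 + 3 * t)) \<or>
         (rasmussen_s 3 w = of_int (writhe w) \<and>
            (\<forall>t \<in> {0..1}. annular_rasmussen 3 w t = of_int (writhe w) - 1 + t)) \<or>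
         (rasmussen_s 3 w = of_int (writhe w) + 2 \<and>
            (\<forall>t \<in> {0..1}. annular_rasmussen 3 w t = of_int (writhe w) + 1 - t))"
proof -
  have "\<beta> \<in> braid_words 3 // braid_rel 3" using assms(1) by (simp add: braid_group_def)
  then have w: "w \<in> braid_words 3"
    using in_quotient_imp_subset[OF equiv_braid_rel] assms(2) by blast
  \<comment> \<open>Since j_0 = j, \<open>?above r\<close> says that d_0 is at least
    \<open>r\<close>; the three cases are therefore thresholds for the s invariant, whose value is
    then read off at t = 0.\<close>
  let ?above = "\<lambda>r. \<exists>x. represents_canonical 3 w x \<and> (\<forall>g \<in> gens 3 w. x g \<noteq> 0 \<longrightarrow> r \<le> quantum_grading 3 w g)"
  consider "?above (writhe w + 1)" | "\<not> ?above (writhe w + 1)" "?above (writhe w - 1)" | "\<not> ?above (writhe w - 1)"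
    by blast
  then show ?thesis
  proof cases
    case 1
    then obtain x where x: "represents_canonical 3 w x"
      "\<forall>g \<in> gens 3 w. x g \<noteq> 0 \<longrightarrow> writhe w + 1 \<le> quantum_grading 3 w g" by blast
    have d: "annular_rasmussen 3 w t = of_int (writhe w) + 1 - t" if "t \<in> {0..1}" for t
      using annular_rasmussen_top[OF w that x] by simp
    then have "rasmussen_s 3 w = of_int (writhe w) + 2" by (simp add: rasmussen_s_def)
    then show ?thesis using d by blast
  next
    case 2
    then obtain x where x: "represents_canonical 3 w x"
      "\<forall>g \<in> gens 3 w. x g \<noteq> 0 \<longrightarrow> writhe w - 1 \<le> quantum_grading 3 w g" by blast
    have d: "annular_rasmussen 3 w t = of_int (writhe w) - 1 + t" if "t \<in> {0..1}" for t
      using annular_rasmussen_middle_ge[OF w that x] annular_rasmussen_middle_le[OF w that 2(1)] by simp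
    then have "rasmussen_s 3 w = of_int (writhe w)" by (simp add: rasmussen_s_def)
    then show ?thesis using d by blast
  next
    case 3
    have d: "annular_rasmussen 3 w t = of_int (writhe w) - 3 + 3 * t" if "t \<in> {0..1}" for t
      using annular_rasmussen_bottom[OF w that 3] by simp
    then have "rasmussen_s 3 w = of_int (writhe w) - 2" by (simp add: rasmussen_s_def)
    then show ?thesis using d by blast
  qed
qed

end
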